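(* Let $\boldsymbol U,\boldsymbol U_P,\widehat{\boldsymbol X},\widehat{\boldsymbol X}_P,\widehat{\boldsymbol X}_+,\widehat{\boldsymbol W}$ be the data matrices of the augmented (reference-tracking) LPV system described in the context, let $\widehat K_{d0}\in\mathbb R^{m\times\bar n}$ and $\widehat{\bar K}_d=[\widehat K_{d1},\dots,\widehat K_{d\ell}]\in\mathbb R^{m\times\ell\bar n}$ be controller gains, and let $\widehat{\mathcal V}\in\mathbb R^{\widehat{\mathcal T}\times\bar n(1+\ell+\ell^2)}$ satisfy $$\begin{bmatrix} I_{\bar n}&0&0 \\ 0&I_\ell\otimes I_{\bar n}&0 \\ \widehat K_{d0}&\widehat{\bar K}_d&0 \\ 0&I_\ell\otimes\widehat K_{d0}&I_\ell\otimes\widehat{\bar K}_d\end{bmatrix}=\widehat{\boldsymbol G}\widehat{\mathcal V}.$$ Suppose that there exist a matrix $P\in\mathbb S^{\bar n}_{++}$ and scalars $\varepsilon_3>0$, $\hat\sigma>1$, $\beta_3\in(0,1)$ such that, for all $p\in\mathcal P$, $$\begin{bmatrix} P&0&\widehat F(p)^\top\widehat{\boldsymbol X}_+^\top&P&\widehat F(p)^\top \\ 0&\hat\sigma P&P&0&0 \\ \widehat{\boldsymbol X}_+\widehat F(p)&P&P-\varepsilon_3\widehat\Delta\widehat\Delta^\top&0&0 \\ P&0&0&\beta_3^{-1}P&0 \\ \widehat F(p)&0&0&0&\varepsilon_3I_{\widehat{\mathcal T}}\end{bmatrix}\succ0,$$ where $\widehat F(p)=\widehat{\mathcal V}\,\mathrm{Col}(I_{\bar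 n},\;p\otimes I_{\bar n},\;p\otimes p\otimes I_{\bar n})\,P$ and $\widehat\Delta=\sqrt{\widehat{\mathcal T}}\,\hat\delta I_{\bar n}$. Then the closed-loop augmented LPV system $$\psi_{k+1}=\big(\widehat A_d(p_k)+\widehat B_d(p_k)\widehat K_d(p_k)\big)\psi_k+\hat\varpi_k,\qquad\widehat K_d(p)=\widehat K_{d0}+\sum_{i=1}^\ell p^{[i]}\widehat K_{di},$$ is exponentially input-to-state stable (ISS).
   Context: Notation. $\mathbb S^n$ ($\mathbb S^n_{++}$) is the set of real symmetric (symmetric positive definite) $n\times n$ matrices; $\otimes$ is the Kronecker product; $\mathrm{Col}(X_1,\dots,X_s)$ stacks its arguments vertically; $p^{[i]}$ is the $i$-th entry of $p\in\mathbb R^\ell$. System. $n,m,r,\ell,\widehat{\mathcal T}$ are positive integers, $\bar n=n+r$, and $\mathcal P\subset\mathbb R^\ell$ is the set of admissible scheduling values. The LPV system is $x_{k+1}=A_d(p_k)x_k+B_d(p_k)u_k+\omega_k$, $y_k=C_d(p_k)x_k+D_d(p_k)u_k$, with $x_k,\omega_k\in\mathbb R^n$, $u_k\in\mathbb R^m$, $y_k\in\mathbb R^r$, $p_k\in\mathcal P$, and $A_d,B_d,C_d,D_d$ affine in $p$ (e.g. $A_d(p)=A_{d0}+\sum_{i=1}^\ell p^{[i]}A_{di}$). For a reference signal $r_k\in\mathbb R^r$ the auxiliary state $\chi_k\in\mathbb R^r$ satisfies $\chi_{k+1}=\chi_k+(y_k-r_k)$. The augmented state $\psi_k=\mathrm{Col}(x_k,\chi_k)\in\mathbb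 R^{\bar n}$ satisfies $\psi_{k+1}=\widehat A_d(p_k)\psi_k+\widehat B_d(p_k)u_k+\hat\varpi_k$ with $\hat\varpi_k=\mathrm{Col}(\omega_k,-r_k)$, $$\widehat A_d(p)=\begin{bmatrix} A_d(p)&0 \\ C_d(p)&I\end{bmatrix},\qquad\widehat B_d(p)=\begin{bmatrix} B_d(p) \\ D_d(p)\end{bmatrix},$$ which are affine in $p$: $\widehat A_d(p)=\widehat A_{d0}+\sum_ip^{[i]}\widehat A_{di}$, $\widehat B_d(p)=\widehat B_{d0}+\sum_ip^{[i]}\widehat B_{di}$. Put $\widehat{\mathcal A}=[\widehat A_{d0},\dots,\widehat A_{d\ell}]$, $\widehat{\mathcal B}=[\widehat B_{d0},\dots,\widehat B_{d\ell}]$. Perturbation assumption. There is a known $\hat\delta>0$ such that $\|\hat\varpi_k\|\le\hat\delta$ for all $k$ (both in the data and in closed-loop operation); in particular $\widehat{\boldsymbol W}\widehat{\boldsymbol W}^\top\preceq\widehat\Delta\widehat\Delta^\top$ with $\widehat\Delta=\sqrt{\widehat{\mathcal T}}\hat\delta I_{\bar n}$. Data. From a trajectory $\{u_k,p_k,\psi_k,\hat\varpi_k\}_{k=0}^{\widehat{\mathcal T}}$ of the augmented system form $\boldsymbol U=[u_0,\dots,u_{\widehat{\mathcal T}-1}]$, $\boldsymbol U_P=[p_0\otimes u_0,\dots,p_{\widehat{\mathcal T}-1}\otimes u_{\widehat{\mathcal T}-1}]$, $\widehat{\boldsymbol X}=[\psi_0,\dots,\psi_{\widehat{\mathcal T}-1}]$,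 $\widehat{\boldsymbol X}_P=[p_0\otimes\psi_0,\dots,p_{\widehat{\mathcal T}-1}\otimes\psi_{\widehat{\mathcal T}-1}]$, $\widehat{\boldsymbol X}_+=[\psi_1,\dots,\psi_{\widehat{\mathcal T}}]$, $\widehat{\boldsymbol W}=[\hat\varpi_0,\dots,\hat\varpi_{\widehat{\mathcal T}-1}]$, so that $\widehat{\boldsymbol X}_+=\widehat{\mathcal A}\,\mathrm{Col}(\widehat{\boldsymbol X},\widehat{\boldsymbol X}_P)+\widehat{\mathcal B}\,\mathrm{Col}(\boldsymbol U,\boldsymbol U_P)+\widehat{\boldsymbol W}$. Put $\widehat{\boldsymbol G}=\mathrm{Col}(\widehat{\boldsymbol X},\widehat{\boldsymbol X}_P,\boldsymbol U,\boldsymbol U_P)$. Exponential ISS. The closed-loop system with state $\psi_k$ and perturbation $\hat\varpi_k$ is exponentially ISS if there exist $\alpha_1,\alpha_2>0$ and a class-$\mathcal K$ function $\gamma$ such that $\|\psi_k\|\le\alpha_1e^{-\alpha_2k}\|\psi_0\|+\gamma\big(\sup_{0\le s\le k-1}\|\hat\varpi_s\|\big)$ for all $k\in\mathbb N$, all $\psi_0$, all scheduling sequences in $\mathcal P$ and all admissible perturbation sequences (a supremum over the empty set is $0$). *)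

theory Defs
  imports "HOL-Analysis.Analysis"
begin

text \<open>A matrix of type \<^typ>\<open>real^'c^'r\<close> has rows indexed by \<open>'r\<close> and columns by \<open>'c\<close>.  Block
  dimensions are rendered by index types: \<open>'a + 'b\<close> for a sum of dimensions and \<open>'a \<times> 'b\<close> for
  a product, where the first component numbers the block and the second the position in it.\<close>

definition vstack :: "real^'c^'a \<Rightarrow> real^'c^'b \<Rightarrow> real^'c^('a::finite + 'b::finite)"
    (infixr "===" 55)
  where "M === N = (\<chi> i. case i of Inl a \<Rightarrow> M $ a | Inr b \<Rightarrow> N $ b)"

definition hstack :: "real^'a^'r \<Rightarrow> real^'b^'r \<Rightarrow> real^('a::finite + 'b::finite)^'r"
    (infixr "|||" 60)
  where "M ||| N = (\<chi> i j. case j of Inl a \<Rightarrow> M $ i $ a | Inr b \<Rightarrow> N $ i $ b)"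

definition stack :: "real^'a \<Rightarrow> real^'b \<Rightarrow> real^('a::finite + 'b::finite)"
  where "stack x y = (\<chi> i. case i of Inl a \<Rightarrow> x $ a | Inr b \<Rightarrow> y $ b)"

definition block_row :: "('l::finite \<Rightarrow> real^'a::finite^'r) \<Rightarrow> real^('l \<times> 'a)^'r"
  where "block_row M = (\<chi> i j. M (fst j) $ i $ snd j)"

definition kron :: "real^'b^'a \<Rightarrow> real^'d^'c \<Rightarrow> real^('b::finite \<times> 'd::finite)^('a::finite \<times> 'c::finite)"
  where "kron M N = (\<chi> i j. M $ fst i $ fst j * N $ snd i $ snd j)"

text \<open>The Kronecker products \<open>p \<otimes> x\<close> and \<open>p \<otimes> M\<close> with a column vector \<open>p\<close>, whose
  single column contributes no factor to the column index.\<close>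

definition kron_vec :: "real^'l \<Rightarrow> real^'a \<Rightarrow> real^('l::finite \<times> 'a::finite)"
  where "kron_vec p x = (\<chi> i. p $ fst i * x $ snd i)"

definition kron_col :: "real^'l \<Rightarrow> real^'c^'a \<Rightarrow> real^'c^('l::finite \<times> 'a::finite)"
  where "kron_col p M = (\<chi> i j. p $ fst i * M $ snd i $ j)"

definition pos_def :: "real^'a^'a \<Rightarrow> bool"
  where "pos_def M \<longleftrightarrow> transpose M = M \<and> (\<forall>x. x \<noteq> 0 \<longrightarrow> 0 < x \<bullet> (M *v x))"

definition affine_mat :: "real^'c^'r \<Rightarrow> ('l::finite \<Rightarrow> real^'c^'r) \<Rightarrow> real^'l \<Rightarrow> real^'c^'r"
  where "affine_mat M0 M p = M0 + (\<Sum>i\<in>UNIV. p $ i *\<^sub>R M i)"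

definition aug_A :: "real^'n^'n \<Rightarrow> real^'n^'r \<Rightarrow> real^('n::finite + 'r::finite)^('n + 'r)"
  where "aug_A A C = ((A ||| 0) === (C ||| mat 1))"

definition aug_B :: "real^'m^'n \<Rightarrow> real^'m^'r \<Rightarrow> real^'m^('n::finite + 'r::finite)"
  where "aug_B B D = (B === D)"

text \<open>The augmented recursion is the plant recursion together with the integrator of the tracking
  error \<open>y - r\<close>.\<close>

lemma stack_mult:
  "aug_A A C *v stack x z = stack (A *v x) (C *v x + z)"
  "aug_B B D *v u = stack (B *v u) (D *v u)"
  by (auto simp: aug_A_def aug_B_def vstack_def hstack_def stack_def matrix_vector_mult_def
        vec_eq_iff UNIV_Plus_UNIV[symmetric] sum.Plus mat_def if_distrib[of "\<lambda>c. c * _"]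
        sum.delta cong: if_cong split: sum.split simp del: UNIV_Plus_UNIV)

lemma augmented_step_iff:
  assumes "y = C *v x + D *v u"
  shows "stack x' c' = aug_A A C *v stack x c + aug_B B D *v u + stack \<omega> (- r) \<longleftrightarrow>
         x' = A *v x + B *v u + \<omega> \<and> c' = c + (y - r)"
  unfolding stack_mult assms by (auto simp: stack_def vec_eq_iff split: sum.split)

text \<open>The columns of a data matrix are indexed by a finite linearly ordered type, whose elements in
  increasing order stand for the sampling times \<open>0, \<dots>, CARD('t) - 1\<close>.\<close>

definition time_index :: "'t::{finite,linorder} \<Rightarrow> nat"
  where "time_index t = card {s. s < t}"

lemma time_index_strict_mono: "strict_mono (time_index :: 't::{finite,linorder} \<Rightarrow> nat)"
  unfolding time_index_def by (intro strict_monoI psubset_card_mono) auto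

lemma time_index_bij: "bij_betw time_index (UNIV :: 't::{finite,linorder} set) {..<CARD('t)}"
proof -
  have inj: "inj (time_index :: 't \<Rightarrow> nat)"
    by (rule strict_mono_imp_inj_on[OF time_index_strict_mono])
  have "range (time_index :: 't \<Rightarrow> nat) \<subseteq> {..<CARD('t)}"
    unfolding time_index_def by (auto intro!: psubset_card_mono)
  moreover have "card (range (time_index :: 't \<Rightarrow> nat)) = card {..<CARD('t)}"
    using card_image[OF inj] by simp
  ultimately have "range (time_index :: 't \<Rightarrow> nat) = {..<CARD('t)}"
    by (intro card_subset_eq) auto
  with inj show ?thesis by (simp add: bij_betw_def)
qed

definition data_matrix :: "(nat \<Rightarrow> real^'a) \<Rightarrow> real^'t::{finite,linorder}^'a"
  where "data_matrix z = (\<chi> i t. z (time_index t) $ i)"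

definition class_K :: "(real \<Rightarrow> real) \<Rightarrow> bool"
  where "class_K \<gamma> \<longleftrightarrow> continuous_on {0..} \<gamma> \<and> strict_mono_on {0..} \<gamma> \<and> \<gamma> 0 = 0"

definition past_sup :: "(nat \<Rightarrow> 'x::real_normed_vector) \<Rightarrow> nat \<Rightarrow> real"
  where "past_sup w k = (if k = 0 then 0 else (SUP s\<in>{0..k-1}. norm (w s)))"

text \<open>Here \<open>f p \<psi> w\<close> is the successor state, \<open>S\<close> the set of scheduling values and \<open>W\<close> the set of
  admissible perturbation values.\<close>

definition exponentially_ISS ::
    "('p \<Rightarrow> 'x \<Rightarrow> 'x \<Rightarrow> 'x::real_normed_vector) \<Rightarrow> 'p set \<Rightarrow> 'x set \<Rightarrow> bool"
  where "exponentially_ISS f S W \<longleftrightarrow>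
    (\<exists>\<alpha>1>0. \<exists>\<alpha>2>0. \<exists>\<gamma>. class_K \<gamma> \<and>
      (\<forall>p w \<psi>. (\<forall>k. p k \<in> S) \<longrightarrow> (\<forall>k. w k \<in> W) \<longrightarrow>
        (\<forall>k. \<psi> (Suc k) = f (p k) (\<psi> k) (w k)) \<longrightarrow>
        (\<forall>k. norm (\<psi> k) \<le> \<alpha>1 * exp (- \<alpha>2 * real k) * norm (\<psi> 0) + \<gamma> (past_sup w k))))"

end

theory Submission
  imports Defs
begin

text \<open>The data equation expresses the closed-loop matrix as \<open>(X\<^sub>+ - W) Z(q)\<close>, where \<open>F(q) = Z(q) P\<close>.
  With \<open>x\<^sup>+\<close> the successor of the state \<open>x\<close> under the perturbation \<open>v\<close>, evaluate the quadratic
  form of the matrix inequality at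
  \<open>(P\<^sup>-\<^sup>1 x, P\<^sup>-\<^sup>1 v, c, - \<beta> P\<^sup>-\<^sup>1 x, - W\<^sup>T c)\<close> with \<open>c = - P\<^sup>-\<^sup>1 x\<^sup>+\<close>.  Since
  \<open>W W\<^sup>T \<preceq> \<Delta> \<Delta>\<^sup>T\<close>, what remains is the decrease \<open>L(x\<^sup>+) \<le> (1 - \<beta>) L(x) + \<sigma> L(v)\<close> of the
  Lyapunov function \<open>L(x) = x \<bullet> P\<^sup>-\<^sup>1 x\<close>, which yields exponential ISS with a linear gain.\<close>

section \<open>Block matrices acting on stacked vectors\<close>

lemma vstack_mult_vec: "(M === N) *v x = stack (M *v x) (N *v x)"
  by (auto simp: vstack_def stack_def matrix_vector_mult_def vec_eq_iff split: sum.split)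

lemma hstack_mult_stack: "(M ||| N) *v stack x y = M *v x + N *v y"
  by (auto simp: hstack_def stack_def matrix_vector_mult_def vec_eq_iff
      UNIV_Plus_UNIV[symmetric] sum.Plus simp del: UNIV_Plus_UNIV)

lemma inner_stack: "stack x y \<bullet> stack x' y' = x \<bullet> x' + y \<bullet> y'"
  by (auto simp: stack_def inner_vec_def UNIV_Plus_UNIV[symmetric] sum.Plus
      simp del: UNIV_Plus_UNIV)

lemma stack_eq_iff: "stack x y = stack x' y' \<longleftrightarrow> x = x' \<and> y = y'"
  by (auto simp: stack_def vec_eq_iff split: sum.split_asm sum.split)

lemma kron_vec_add: "kron_vec q (x + y) = kron_vec q x + kron_vec q y"
  by (simp add: kron_vec_def vec_eq_iff distrib_left)

lemma kron_col_mult_vec: "kron_col q M *v x = kron_vec q (M *v x)"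
  by (auto simp: kron_col_def kron_vec_def matrix_vector_mult_def vec_eq_iff
      sum_distrib_left mult.assoc)

lemma sum_UNIV_prod: "(\<Sum>j\<in>UNIV. g j) = (\<Sum>a\<in>UNIV. \<Sum>b\<in>UNIV. g (a, b))"
  by (simp add: sum.cartesian_product)

text \<open>Mixed-product rule. It evaluates the block row with \<open>K0\<close> and
  \<open>K_bar\<close> in the gain equation, where \<open>x\<close> is a state or again a Kronecker
  product.\<close>

lemma kron_mat_1_mult_kron_vec: "kron (mat 1) M *v kron_vec q x = kron_vec q (M *v x)"
proof -
  have "(\<Sum>a\<in>UNIV. \<Sum>b\<in>UNIV. (mat 1 :: real^'a^'a) $ i $ a * M $ k $ b * (q $ a * x $ b))
      = (\<Sum>a\<in>UNIV. if a = i then q $ a * (\<Sum>b\<in>UNIV. M $ k $ b * x $ b) else 0)" for i k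
    by (rule sum.cong) (auto simp: mat_def sum_distrib_left mult_ac)
  then show ?thesis
    by (simp add: kron_def kron_vec_def matrix_vector_mult_def vec_eq_iff sum_UNIV_prod)
qed

lemma block_row_mult_kron_vec: "block_row M *v kron_vec q x = (\<Sum>i\<in>UNIV. q $ i *\<^sub>R (M i *v x))"
  by (simp add: block_row_def kron_vec_def matrix_vector_mult_def vec_eq_iff sum_UNIV_prod
      sum_distrib_left mult_ac)

text \<open>Moves the scheduling value out of the coefficients and into \<open>kron_vec q x\<close>,
  the form in which it enters the data matrices \<open>XP\<close> and \<open>UP\<close>.\<close>

lemma affine_mat_mult_vec: "affine_mat M0 M q *v x = M0 *v x + block_row M *v kron_vec q x"
proof -
  have "(\<Sum>i\<in>UNIV. q $ i *\<^sub>R M i) *v x = (\<Sum>i\<in>UNIV. q $ i *\<^sub>R (M i *v x))"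
    by (simp add: vec_eq_iff matrix_vector_mult_def sum_distrib_left sum_distrib_right mult.assoc)
      (intro allI sum.swap)
  then show ?thesis
    by (simp add: affine_mat_def block_row_mult_kron_vec matrix_vector_mult_add_rdistrib)
qed

text \<open>The identity block of the integrator is constant in \<open>q\<close>, so it belongs to
  the constant coefficient alone.\<close>

lemma aug_A_affine_mat:
  "aug_A (affine_mat A0 A q) (affine_mat C0 C q)
    = affine_mat (aug_A A0 C0) (\<lambda>i. (A i ||| 0) === (C i ||| 0)) q"
  by (auto simp: aug_A_def affine_mat_def vstack_def hstack_def vec_eq_iff split: sum.split)

lemma aug_B_affine_mat:
  "aug_B (affine_mat B0 B q) (affine_mat D0 D q)
    = affine_mat (aug_B B0 D0) (\<lambda>i. B i === D i) q"
  by (auto simp: aug_B_def affine_mat_def vstack_def vec_eq_iff split: sum.split)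

section \<open>Data matrices\<close>

lemma data_matrix_mult_vec:
  "(data_matrix f :: real^'t::{finite,linorder}^'a) *v z
    = (\<Sum>t\<in>UNIV. z $ t *\<^sub>R f (time_index t))"
  by (simp add: data_matrix_def matrix_vector_mult_def vec_eq_iff mult.commute)

lemma time_index_less: "time_index (t :: 't::{finite,linorder}) < CARD('t)"
  using time_index_bij[where 't='t] by (auto simp: bij_betw_def)

text \<open>The data equation applied to \<open>z\<close>: sum the recursion over the samples with
  weights \<open>z $ t\<close>. The coefficients do not depend on time and leave the sum.\<close>

lemma data_matrix_affine_step:
  fixes z :: "real^'t::{finite,linorder}"
  assumes "\<forall>k<CARD('t). \<psi> (Suc k)
      = affine_mat A0 A (p k) *v \<psi> k + affine_mat B0 B (p k) *v u k + w k"
  shows "data_matrix (\<lambda>k. \<psi> (Suc k)) *v z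
    = A0 *v (data_matrix \<psi> *v z) + block_row A *v (data_matrix (\<lambda>k. kron_vec (p k) (\<psi> k)) *v z)
      + B0 *v (data_matrix u *v z) + block_row B *v (data_matrix (\<lambda>k. kron_vec (p k) (u k)) *v z)
      + data_matrix w *v z"
  using assms
  by (simp add: data_matrix_mult_vec time_index_less affine_mat_mult_vec scaleR_right_distrib
      sum.distrib linear_sum[OF matrix_vector_mul_linear] matrix_vector_mult_scaleR)

text \<open>Vector form of W W^T \<le> \<Delta> \<Delta>^T. The entries of W^T c are the inner
  products of the samples with \<open>c\<close>, each bounded by Cauchy-Schwarz.\<close>

lemma norm_transpose_data_matrix_le:
  fixes c :: "real^'a"
  assumes "\<forall>k<CARD('t::{finite,linorder}). norm (w k) \<le> \<delta>"
  shows "(norm (transpose (data_matrix w :: real^'t::{finite,linorder}^'a) *v c))\<^sup>2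
    \<le> real CARD('t::{finite,linorder}) * \<delta>\<^sup>2 * (norm c)\<^sup>2"
proof -
  have "(norm (transpose (data_matrix w :: real^'t::{finite,linorder}^'a) *v c))\<^sup>2
      = (\<Sum>t\<in>UNIV. (w (time_index (t :: 't::{finite,linorder})) \<bullet> c)\<^sup>2)"
    unfolding power2_norm_eq_inner
    by (simp add: inner_vec_def data_matrix_def transpose_def matrix_vector_mult_def
        power2_eq_square)
  also have "\<dots> \<le> (\<Sum>t\<in>(UNIV :: 't::{finite,linorder} set). (\<delta> * norm c)\<^sup>2)"
  proof (rule sum_mono)
    fix t :: "'t::{finite,linorder}"
    have "\<bar>w (time_index t) \<bullet> c\<bar> \<le> \<delta> * norm c"
      using assms time_index_less[of t]
      by (intro order_trans[OF Cauchy_Schwarz_ineq2] mult_right_mono) auto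
    then show "(w (time_index t) \<bullet> c)\<^sup>2 \<le> (\<delta> * norm c)\<^sup>2"
      by (metis abs_ge_zero power2_abs power_mono)
  qed
  finally show ?thesis by (simp add: power_mult_distrib)
qed

section \<open>Positive definite matrices\<close>

lemma pos_def_nonneg: "pos_def M \<Longrightarrow> 0 \<le> x \<bullet> (M *v x)"
  by (cases "x = 0") (auto simp: pos_def_def less_imp_le)

lemma pos_def_invertible:
  assumes "pos_def M"
  shows "invertible M"
proof -
  have "x = 0" if "M *v x = 0" for x
    using that assms by (force simp: pos_def_def)
  then show ?thesis
    by (simp add: invertible_left_inverse matrix_left_invertible_ker)
qed

lemma pos_def_inverse:
  assumes "pos_def M" and inv: "M ** N = mat 1"
  shows "pos_def N"
proof -
  have MN: "M *v (N *v x) = x" for x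
    by (simp add: matrix_vector_mul_assoc inv)
  have sym: "transpose M = M"
    using assms by (simp add: pos_def_def)
  have "transpose N ** M = mat 1"
    using arg_cong[OF inv, of transpose] by (simp add: matrix_transpose_mul sym)
  then have "transpose N = N"
    by (metis inv matrix_mul_assoc matrix_mul_lid matrix_mul_rid)
  moreover have "0 < x \<bullet> (N *v x)" if "x \<noteq> 0" for x
  proof -
    have "N *v x \<noteq> 0" using MN[of x] that by auto
    then have "0 < (N *v x) \<bullet> (M *v (N *v x))"
      using assms by (simp add: pos_def_def)
    then show ?thesis by (simp add: MN inner_commute)
  qed
  ultimately show ?thesis by (simp add: pos_def_def)
qed

text \<open>The constants are the extreme values of the quadratic form on the compact unit sphere;
  homogeneity of degree two extends the bounds to all vectors.\<close>

lemma pos_def_bounds: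
  fixes M :: "real^'a^'a"
  assumes "pos_def M"
  obtains a b where "0 < a" "0 < b"
    "\<And>x. a * (norm x)\<^sup>2 \<le> x \<bullet> (M *v x)" "\<And>x. x \<bullet> (M *v x) \<le> b * (norm x)\<^sup>2"
proof -
  let ?S = "sphere (0 :: real^'a) 1"
  let ?f = "\<lambda>x. x \<bullet> (M *v x)"
  have cont: "continuous_on ?S ?f"
    by (intro continuous_intros matrix_vector_mult_linear_continuous_on)
  have ne: "?S \<noteq> {}" by simp
  obtain y where y: "y \<in> ?S" "\<And>x. x \<in> ?S \<Longrightarrow> ?f y \<le> ?f x"
    using continuous_attains_inf[OF compact_sphere ne cont] by auto
  obtain z where z: "z \<in> ?S" "\<And>x. x \<in> ?S \<Longrightarrow> ?f x \<le> ?f z"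
    using continuous_attains_sup[OF compact_sphere ne cont] by auto
  have pos: "0 < ?f x" if "x \<in> ?S" for x
    using that assms by (metis pos_def_def norm_zero mem_sphere_0 zero_neq_one)
  have scale: "?f x = ?f (x /\<^sub>R norm x) * (norm x)\<^sup>2" for x
    by (cases "x = 0") (simp_all add: matrix_vector_mult_scaleR power2_eq_square field_simps)
  have "?f y * (norm x)\<^sup>2 \<le> ?f x \<and> ?f x \<le> ?f z * (norm x)\<^sup>2" for x
  proof (cases "x = 0")
    case False
    then have "x /\<^sub>R norm x \<in> ?S" by simp
    then show ?thesis
      unfolding scale[of x] by (intro conjI mult_right_mono y(2) z(2)) auto
  qed simp
  then show ?thesis using that pos y(1) z(1) by blast
qed

section \<open>Exponential ISS from a quadratic Lyapunov function\<close>

lemma norm_le_past_sup: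
  assumes "s < k"
  shows "norm (w s) \<le> past_sup w k"
  using assms by (auto simp: past_sup_def intro!: cSUP_upper)

lemma past_sup_nonneg: "0 \<le> past_sup w k"
proof (cases "k = 0")
  case False
  then show ?thesis
    using norm_le_past_sup[of 0 k w] norm_ge_zero[of "w 0"] by linarith
qed (simp add: past_sup_def)

text \<open>The offset \<open>c / \<beta>\<close> is the fixed point of s -> (1 - \<beta>) s + c, so
  the induction reproduces it unchanged.\<close>

lemma geometric_recursion_bound:
  fixes L :: "nat \<Rightarrow> real"
  assumes \<beta>: "0 < \<beta>" "\<beta> < 1" and "0 \<le> c"
    and step: "\<And>s. s < k \<Longrightarrow> L (Suc s) \<le> (1 - \<beta>) * L s + c"
  shows "L k \<le> (1 - \<beta>) ^ k * L 0 + c / \<beta>"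
  using step
proof (induction k)
  case 0
  then show ?case using assms by simp
next
  case (Suc k)
  then have "L k \<le> (1 - \<beta>) ^ k * L 0 + c / \<beta>" by simp
  then have "(1 - \<beta>) * L k + c \<le> (1 - \<beta>) * ((1 - \<beta>) ^ k * L 0 + c / \<beta>) + c"
    using \<beta> by (intro add_right_mono mult_left_mono) auto
  also have "\<dots> = (1 - \<beta>) ^ Suc k * L 0 + c / \<beta>"
    using \<beta> by (simp add: field_simps)
  finally show ?case using Suc.prems[of k] by simp
qed

lemma exponentially_ISS_quadratic_Lyapunov:
  fixes f :: "'p \<Rightarrow> 'x \<Rightarrow> 'x \<Rightarrow> 'x::real_normed_vector" and L :: "'x \<Rightarrow> real"
  assumes ab: "0 < a" "0 < b"
    and lower: "\<And>x. a * (norm x)\<^sup>2 \<le> L x" and upper: "\<And>x. L x \<le> b * (norm x)\<^sup>2"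
    and \<beta>: "0 < \<beta>" "\<beta> < 1" and \<sigma>: "0 < \<sigma>"
    and decrease: "\<And>q x v. q \<in> S \<Longrightarrow> v \<in> W \<Longrightarrow> L (f q x v) \<le> (1 - \<beta>) * L x + \<sigma> * L v"
  shows "exponentially_ISS f S W"
proof -
  \<comment> \<open>The half is due to a square root: L decays like (1 - \<beta>)^k but is
    comparable to the squared norm. Likewise \<open>g\<close> squared is the factor of the squared
    perturbation after division by \<open>a\<close>.\<close>
  define \<alpha> where "\<alpha> = - ln (1 - \<beta>) / 2"
  define g where "g = sqrt (\<sigma> * b / (\<beta> * a))"
  have "0 < \<alpha>" using \<beta> by (simp add: \<alpha>_def)
  have "0 < g" using assms by (simp add: g_def)
  have bound: "norm (\<psi> k) \<le> sqrt (b / a) * exp (- \<alpha> * real k) * norm (\<psi> 0) + g * past_sup w k"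
    if S: "\<forall>k. p k \<in> S" and W: "\<forall>k. w k \<in> W" and step: "\<forall>k. \<psi> (Suc k) = f (p k) (\<psi> k) (w k)"
    for p w \<psi> k
  proof -
    let ?M = "past_sup w k"
    \<comment> \<open>With the horizon \<open>k\<close> fixed, one constant bounds all earlier
      perturbations, as the recursion bound requires.\<close>
    have "L (w s) \<le> b * ?M\<^sup>2" if "s < k" for s
      using norm_le_past_sup[OF that, of w] ab
      by (intro order_trans[OF upper] mult_left_mono power_mono) auto
    then have "L (\<psi> (Suc s)) \<le> (1 - \<beta>) * L (\<psi> s) + \<sigma> * (b * ?M\<^sup>2)" if "s < k" for s
      using decrease[of "p s" "w s" "\<psi> s"] S W step \<sigma> that
      by (smt (verit) mult_left_mono)
    then have "L (\<psi> k) \<le> (1 - \<beta>) ^ k * L (\<psi> 0) + \<sigma> * (b * ?M\<^sup>2) / \<beta>"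
      using \<beta> \<sigma> ab by (intro geometric_recursion_bound[of \<beta> _ k "\<lambda>k. L (\<psi> k)"]) auto
    also have "\<dots> \<le> (1 - \<beta>) ^ k * (b * (norm (\<psi> 0))\<^sup>2) + \<sigma> * (b * ?M\<^sup>2) / \<beta>"
      using \<beta> upper by (intro add_right_mono mult_left_mono) auto
    finally have "a * (norm (\<psi> k))\<^sup>2
        \<le> (1 - \<beta>) ^ k * (b * (norm (\<psi> 0))\<^sup>2) + \<sigma> * (b * ?M\<^sup>2) / \<beta>"
      using lower[of "\<psi> k"] by linarith
    then have "(norm (\<psi> k))\<^sup>2
        \<le> b / a * (1 - \<beta>) ^ k * (norm (\<psi> 0))\<^sup>2 + \<sigma> * b / (\<beta> * a) * ?M\<^sup>2"
      using ab \<beta> by (simp add: field_simps)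
    also have "(1 - \<beta>) ^ k = (exp (- \<alpha> * real k))\<^sup>2"
    proof -
      have "(1 - \<beta>) ^ k = exp (ln (1 - \<beta>)) ^ k" using \<beta> by simp
      also have "\<dots> = (exp (- \<alpha> * real k))\<^sup>2"
        by (simp add: \<alpha>_def mult.commute flip: exp_of_nat_mult exp_double)
      finally show ?thesis .
    qed
    also have "b / a * (exp (- \<alpha> * real k))\<^sup>2 * (norm (\<psi> 0))\<^sup>2 + \<sigma> * b / (\<beta> * a) * ?M\<^sup>2
        = (sqrt (b / a) * exp (- \<alpha> * real k) * norm (\<psi> 0))\<^sup>2 + (g * ?M)\<^sup>2"
      using ab \<beta> \<sigma> by (simp add: g_def power_mult_distrib)
    \<comment> \<open>Both summands are nonnegative, so the cross term of the square is too.\<close>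
    also have "\<dots> \<le> (sqrt (b / a) * exp (- \<alpha> * real k) * norm (\<psi> 0) + g * ?M)\<^sup>2"
      using ab \<open>0 < g\<close> past_sup_nonneg[of w k] by (simp add: power2_sum)
    finally show ?thesis
      by (rule power2_le_imp_le) (use ab \<open>0 < g\<close> past_sup_nonneg[of w k] in simp)
  qed
  have "class_K (\<lambda>s. g * s)"
    using \<open>0 < g\<close> by (auto simp: class_K_def strict_mono_on_def intro!: continuous_intros)
  then show ?thesis
    unfolding exponentially_ISS_def
    using \<open>0 < \<alpha>\<close> ab bound
    by (intro exI[of _ "sqrt (b / a)"] conjI exI[of _ \<alpha>] exI[of _ "\<lambda>s. g * s"]) auto
qed

section \<open>Closed loop in terms of data, and the decrease along it\<close>

theorem theorem5:
  fixes \<P> :: "(real^'l::finite) set"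
    and Ad0 :: "real^'n::finite^'n" and Adi :: "'l \<Rightarrow> real^'n^'n"
    and Bd0 :: "real^'m::finite^'n" and Bdi :: "'l \<Rightarrow> real^'m^'n"
    and Cd0 :: "real^'n^'r::finite" and Cdi :: "'l \<Rightarrow> real^'n^'r"
    and Dd0 :: "real^'m^'r" and Ddi :: "'l \<Rightarrow> real^'m^'r"
    and A_hat :: "real^'l \<Rightarrow> real^('n + 'r)^('n + 'r)"
    and B_hat :: "real^'l \<Rightarrow> real^'m^('n + 'r)"
    and u :: "nat \<Rightarrow> real^'m" and p :: "nat \<Rightarrow> real^'l"
    and \<psi> w :: "nat \<Rightarrow> real^('n + 'r)" and \<delta> :: real
    and U :: "real^'t::{finite,linorder}^'m" and UP :: "real^'t::{finite,linorder}^('l \<times> 'm)"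
    and X Xplus W :: "real^'t::{finite,linorder}^('n + 'r)" and XP :: "real^'t::{finite,linorder}^('l \<times> ('n + 'r))"
    and \<Delta> :: "real^('n + 'r)^('n + 'r)"
    and K0 :: "real^('n + 'r)^'m" and Ki :: "'l \<Rightarrow> real^('n + 'r)^'m"
    and K_bar :: "real^('l \<times> ('n + 'r))^'m"
    and V :: "real^(('n + 'r) + ('l \<times> ('n + 'r)) + ('l \<times> 'l \<times> ('n + 'r)))^'t::{finite,linorder}"
    and P :: "real^('n + 'r)^('n + 'r)" and \<epsilon> \<sigma> \<beta> :: real
    and F :: "real^'l \<Rightarrow> real^('n + 'r)^'t::{finite,linorder}"
  assumes A_hat: "A_hat = (\<lambda>q. aug_A (affine_mat Ad0 Adi q) (affine_mat Cd0 Cdi q))"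
    and B_hat: "B_hat = (\<lambda>q. aug_B (affine_mat Bd0 Bdi q) (affine_mat Dd0 Ddi q))"
    and trajectory:
      "\<forall>k<CARD('t). \<psi> (Suc k) = A_hat (p k) *v \<psi> k + B_hat (p k) *v u k + w k"
    and scheduling: "\<forall>k\<le>CARD('t). p k \<in> \<P>"
    and \<delta>_pos: "0 < \<delta>"
    and perturbation: "\<forall>k\<le>CARD('t). norm (w k) \<le> \<delta>"
    and U: "U = data_matrix u"
    and UP: "UP = data_matrix (\<lambda>k. kron_vec (p k) (u k))"
    and X: "X = data_matrix \<psi>"
    and XP: "XP = data_matrix (\<lambda>k. kron_vec (p k) (\<psi> k))"
    and Xplus: "Xplus = data_matrix (\<lambda>k. \<psi> (Suc k))"
    and W: "W = data_matrix w"
    and \<Delta>: "\<Delta> = (sqrt (real CARD('t)) * \<delta>) *\<^sub>R mat 1"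
    and K_bar: "K_bar = block_row Ki"
    and V:
      "((mat 1 ||| 0 ||| 0) ===
        (0 ||| kron (mat 1 :: real^'l^'l) (mat 1 :: real^('n + 'r)^('n + 'r)) ||| 0) ===
        (K0 ||| K_bar ||| 0) ===
        (0 ||| kron (mat 1 :: real^'l^'l) K0 ||| kron (mat 1 :: real^'l^'l) K_bar))
       = (X === XP === U === UP) ** V"
    and P: "pos_def P"
    and \<epsilon>: "0 < \<epsilon>" and \<sigma>: "1 < \<sigma>" and \<beta>: "0 < \<beta>" "\<beta> < 1"
    and F: "F = (\<lambda>q. V ** (mat 1 === kron_col q (mat 1) === kron_col q (kron_col q (mat 1))) ** P)"
    and LMI: "\<forall>q\<in>\<P>. pos_def
      ((P ||| 0 ||| transpose (F q) ** transpose Xplus ||| P ||| transpose (F q)) ===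
       (0 ||| \<sigma> *\<^sub>R P ||| P ||| 0 ||| 0) ===
       (Xplus ** F q ||| P ||| P - \<epsilon> *\<^sub>R (\<Delta> ** transpose \<Delta>) ||| 0 ||| 0) ===
       (P ||| 0 ||| 0 ||| inverse \<beta> *\<^sub>R P ||| 0) ===
       (F q ||| 0 ||| 0 ||| 0 ||| \<epsilon> *\<^sub>R mat 1))"
  shows "exponentially_ISS
    (\<lambda>q x v. (A_hat q + B_hat q ** affine_mat K0 Ki q) *v x + v) \<P> {v. norm v \<le> \<delta>}"
proof -
  obtain Q where PQ: "P ** Q = mat 1"
    using pos_def_invertible[OF P] by (auto simp: invertible_def)
  have PQv: "P *v (Q *v x) = x" for x
    by (simp add: matrix_vector_mul_assoc PQ)
  have sym: "(P *v x) \<bullet> y = x \<bullet> (P *v y)" for x y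
    using P dot_lmul_matrix[of x P y] by (simp add: pos_def_def flip: transpose_matrix_vector)
  have posQ: "pos_def Q" by (rule pos_def_inverse[OF P PQ])
  define Acl where "Acl q = A_hat q + B_hat q ** affine_mat K0 Ki q" for q
  have closed_loop: "Acl q *v x = Xplus *v (F q *v (Q *v x)) - W *v (F q *v (Q *v x))" for q x
  proof -
    let ?z = "F q *v (Q *v x)"
    let ?K = "affine_mat K0 Ki q"
    \<comment> \<open>The trailing factor \<open>P\<close> of \<open>F q\<close> cancels against
      \<open>Q\<close>, the inverse of \<open>P\<close>.\<close>
    have z: "?z = V *v stack x (stack (kron_vec q x) (kron_vec q (kron_vec q x)))"
      by (simp add: F vstack_mult_vec kron_col_mult_vec PQv flip: matrix_vector_mul_assoc)
    have "(X === XP === U === UP) *v ?z = ((X === XP === U === UP) ** V)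
        *v stack x (stack (kron_vec q x) (kron_vec q (kron_vec q x)))"
      unfolding z by (rule matrix_vector_mul_assoc)
    also have "\<dots> = stack x (stack (kron_vec q x) (stack (?K *v x) (kron_vec q (?K *v x))))"
      unfolding V[symmetric]
      by (simp add: vstack_mult_vec hstack_mult_stack kron_mat_1_mult_kron_vec K_bar
          affine_mat_mult_vec kron_vec_add)
    finally have data: "X *v ?z = x" "XP *v ?z = kron_vec q x" "U *v ?z = ?K *v x"
        "UP *v ?z = kron_vec q (?K *v x)"
      by (auto simp: vstack_mult_vec stack_eq_iff)
    \<comment> \<open>The weights \<open>?z\<close> combine the samples into exactly the state and
      input of one closed-loop step at \<open>q\<close>, so the data equation evaluates the unknown
      matrices there.\<close>
    have "Xplus *v ?z = A_hat q *v x + B_hat q *v (?K *v x) + W *v ?z"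
      using data_matrix_affine_step[OF trajectory[unfolded A_hat B_hat aug_A_affine_mat aug_B_affine_mat],
          of ?z] data
      by (simp add: A_hat B_hat aug_A_affine_mat aug_B_affine_mat X XP U UP Xplus W
          affine_mat_mult_vec[of "aug_A _ _"] affine_mat_mult_vec[of "aug_B _ _"] add.assoc)
    then show ?thesis
      by (simp add: Acl_def matrix_vector_mult_add_rdistrib matrix_vector_mul_assoc)
  qed
  have decrease: "(Acl q *v x + v) \<bullet> (Q *v (Acl q *v x + v))
      \<le> (1 - \<beta>) * (x \<bullet> (Q *v x)) + \<sigma> * (v \<bullet> (Q *v v))" if "q \<in> \<P>" for q x v
  proof -
    define y where "y = Acl q *v x + v"
    \<comment> \<open>Each choice has a purpose: \<open>c\<close> minimizes 2 c \<bullet> y + c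
      \<bullet> P c, with value - y \<bullet> Q y; \<open>e\<close> makes its cross term with
      \<open>?f\<close> replace \<open>Xplus\<close> by \<open>Xplus - W\<close>. The fourth block -
      \<beta> a, used below, minimizes 2 d \<bullet> P a + d \<bullet> P d / \<beta> over d, with
      value - \<beta> a \<bullet> P a.\<close>
    define a b c where "a = Q *v x" and "b = Q *v v" and "c = - (Q *v y)"
    define e where "e = - (transpose W *v c)"
    let ?f = "F q *v a"
    have W_bound: "e \<bullet> e \<le> real CARD('t) * \<delta>\<^sup>2 * (c \<bullet> c)"
      using norm_transpose_data_matrix_le[of w \<delta> c, where 't='t] perturbation
      by (simp add: e_def W power2_norm_eq_inner)
    have \<Delta>\<Delta>: "\<Delta> ** transpose \<Delta> = (real CARD('t) * \<delta>\<^sup>2) *\<^sub>R mat 1"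
      by (simp add: \<Delta> transpose_scalar matrix_scalar_ac power2_eq_square
          flip: scalar_matrix_assoc)
    have ce: "e \<bullet> ?f = - (c \<bullet> (W *v ?f))"
      by (simp add: e_def dot_lmul_matrix)
    have adj: "a \<bullet> (y v* F q) = y \<bullet> ?f" "(z v* Xplus) \<bullet> ?f = z \<bullet> (Xplus *v ?f)" for y z
      by (simp_all add: dot_lmul_matrix inner_commute[of a])
    have Pcb: "b \<bullet> (P *v c) = c \<bullet> (P *v b)"
      using sym[of b c] by (simp add: inner_commute)
    have "0 \<le> a \<bullet> (P *v a) + 2 * (c \<bullet> (Xplus *v ?f)) - 2 * \<beta> * (a \<bullet> (P *v a)) + 2 * (e \<bullet> ?f)
        + \<sigma> * (b \<bullet> (P *v b)) + 2 * (c \<bullet> (P *v b)) + c \<bullet> (P *v c)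
        - \<epsilon> * (real CARD('t) * \<delta>\<^sup>2 * (c \<bullet> c)) + \<beta> * (a \<bullet> (P *v a)) + \<epsilon> * (e \<bullet> e)"
      using pos_def_nonneg[OF LMI[rule_format, OF that],
          of "stack a (stack b (stack c (stack (- \<beta> *\<^sub>R a) e)))"] \<beta>
      by (simp add: vstack_mult_vec hstack_mult_stack inner_stack \<Delta>\<Delta> adj Pcb
          matrix_vector_mult_diff_rdistrib matrix_vector_mult_scaleR inner_simps
          linear_neg[OF matrix_vector_mul_linear] scaleR_matrix_vector_assoc[symmetric] algebra_simps
          flip: matrix_vector_mul_assoc)
    \<comment> \<open>By \<open>W_bound\<close>, the term \<epsilon> e \<bullet> e is absorbed by
      the negative term that \<Delta> contributes.\<close>
    also have "\<dots> \<le> (1 - \<beta>) * (a \<bullet> (P *v a)) + \<sigma> * (b \<bullet> (P *v b))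
        + 2 * (c \<bullet> (Xplus *v ?f - W *v ?f + P *v b)) + c \<bullet> (P *v c)"
      using mult_left_mono[OF W_bound, of \<epsilon>] \<epsilon>
      by (simp add: ce algebra_simps inner_simps)
    also have "Xplus *v ?f - W *v ?f + P *v b = y"
      by (simp add: a_def b_def y_def closed_loop PQv)
    \<comment> \<open>Substituting \<open>c\<close> turns the last two terms into - y \<bullet> Q y,
      while a \<bullet> P a and b \<bullet> P b become the Lyapunov values of \<open>x\<close> and
      \<open>v\<close>.\<close>
    finally show ?thesis
      by (simp add: a_def b_def c_def PQv linear_neg[OF matrix_vector_mul_linear] inner_commute
          flip: y_def)
  qed
  show ?thesis
  proof (rule pos_def_bounds[OF posQ])
    fix l h :: real
    assume "0 < l" "0 < h"
      "\<And>x. l * (norm x)\<^sup>2 \<le> x \<bullet> (Q *v x)" "\<And>x. x \<bullet> (Q *v x) \<le> h * (norm x)\<^sup>2"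
    then show ?thesis
      using \<sigma> \<beta> decrease
      by (intro exponentially_ISS_quadratic_Lyapunov[where L = "\<lambda>x. x \<bullet> (Q *v x)"
            and a = l and b = h and \<beta> = \<beta> and \<sigma> = \<sigma>]) (auto simp: Acl_def)
  qed
qed

end
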